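(* $\mathsf{ERT}<_{\mathrm W}\mathsf{ECT}$.
   Context: A Weihrauch problem is a relation $P\subseteq\mathbb N^{\mathbb N}\times\mathbb N$, viewed as a multifunction taking an instance $I\in\mathrm{domain}(P)$ to any solution $S$ with $(I,S)\in P$ (with numbers and pairs coded in the standard computable way where needed). $P\le_{\mathrm W}Q$ means that there are computable functionals $\Phi,\Psi$ such that for all $I\in\mathrm{domain}(P)$, $\Phi(I)\in\mathrm{domain}(Q)$, and for all $S$ with $(\Phi(I),S)\in Q$ we have $(I,\Psi(I,S))\in P$. $P<_{\mathrm W}Q$ means $P\le_{\mathrm W}Q$ and $Q\not\le_{\mathrm W}P$. $\mathsf{ERT}$: an instance is a number $k$ and a function $f:\mathbb N\to k$ (where $k=\{0,\dots,k-1\}$); a solution is any $b\in\mathbb N$ such that $\forall n\ge b\,\exists m\ge b\,(m\ne n\wedge f(m)=f(n))$. $\mathsf{ECT}$: an instance is a number $k$ and a function $f:\mathbb N\to k$; a solution is any $b\in\mathbb N$ such that for all $x\ge b$ there is a $y>x$ with $f(x)=f(y)$. *)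

theory Defs
  imports Main
begin

section \<open>Computability relative to an oracle\<close>

text \<open>
  Kleene's partial recursive functions relative to an oracle in Baire space. Terms carry no
  arity: applying a term to an unsuitable argument list is undefined or ignores the surplus
  arguments.
\<close>

datatype recf =
    Zero
  | Succ
  | Proj nat
  | Oracle
  | Comp recf "recf list"
  | Prec recf recf
  | Mu recf

text \<open>
  The value \<^term>\<open>None\<close> means divergence. Composition and primitive recursion are strict, and
  unbounded search for \<open>z\<close> converges only if the search function converges at every \<open>y < z\<close>.
\<close>

fun eval :: "(nat \<Rightarrow> nat) \<Rightarrow> recf \<Rightarrow> nat list \<Rightarrow> nat option" where
  "eval A Zero xs = Some 0"
| "eval A Succ xs = (case xs of [x] \<Rightarrow> Some (Suc x) | _ \<Rightarrow> None)"
| "eval A (Proj i) xs = (if i < length xs then Some (xs ! i) else None)"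
| "eval A Oracle xs = (case xs of [x] \<Rightarrow> Some (A x) | _ \<Rightarrow> None)"
| "eval A (Comp f gs) xs =
     Option.bind (those (map (\<lambda>g. eval A g xs) gs)) (\<lambda>ys. eval A f ys)"
| "eval A (Prec f g) xs =
     (case xs of
        [] \<Rightarrow> None
      | n # ys \<Rightarrow>
          rec_nat (eval A f ys) (\<lambda>m r. Option.bind r (\<lambda>v. eval A g (m # v # ys))) n)"
| "eval A (Mu f) xs =
     (if \<exists>z. eval A f (z # xs) = Some 0 \<and> (\<forall>y<z. eval A f (y # xs) \<noteq> None)
      then Some (LEAST z. eval A f (z # xs) = Some 0)
      else None)"

text \<open>
  As usual for partial functionals, computability only constrains the behaviour of the program on
  the domain of the functional; nothing is required of the domain itself.
\<close>

definition computable_functional :: "((nat \<Rightarrow> nat) \<Rightarrow> (nat \<Rightarrow> nat) option) \<Rightarrow> bool" where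
  "computable_functional \<Phi> \<longleftrightarrow>
     (\<exists>e. \<forall>I J. \<Phi> I = Some J \<longrightarrow> (\<forall>n. eval I e [n] = Some (J n)))"

definition computable_functional2 :: "((nat \<Rightarrow> nat) \<Rightarrow> nat \<Rightarrow> nat option) \<Rightarrow> bool" where
  "computable_functional2 \<Psi> \<longleftrightarrow>
     (\<exists>e. \<forall>I S T. \<Psi> I S = Some T \<longrightarrow> eval I e [S] = Some T)"

section \<open>Weihrauch reducibility\<close>

type_synonym weihrauch_problem = "((nat \<Rightarrow> nat) \<times> nat) set"

definition weihrauch_le :: "weihrauch_problem \<Rightarrow> weihrauch_problem \<Rightarrow> bool"
    (infix "\<le>\<^sub>W" 50) where
  "P \<le>\<^sub>W Q \<longleftrightarrow>
     (\<exists>\<Phi> \<Psi>. computable_functional \<Phi> \<and> computable_functional2 \<Psi> \<and>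
        (\<forall>I \<in> Domain P. \<exists>J. \<Phi> I = Some J \<and> J \<in> Domain Q \<and>
           (\<forall>S. (J, S) \<in> Q \<longrightarrow> (\<exists>T. \<Psi> I S = Some T \<and> (I, T) \<in> P))))"

definition weihrauch_less :: "weihrauch_problem \<Rightarrow> weihrauch_problem \<Rightarrow> bool"
    (infix "<\<^sub>W" 50) where
  "P <\<^sub>W Q \<longleftrightarrow> P \<le>\<^sub>W Q \<and> \<not> Q \<le>\<^sub>W P"

section \<open>The problems ERT and ECT\<close>

text \<open>The pair of \<open>k\<close> and \<open>f\<close> is coded as the sequence \<open>k, f 0, f 1, \<dots>\<close>.\<close>

definition coloring_code :: "nat \<Rightarrow> (nat \<Rightarrow> nat) \<Rightarrow> (nat \<Rightarrow> nat)" where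
  "coloring_code k f = case_nat k f"

definition ERT :: weihrauch_problem where
  "ERT = {(coloring_code k f, b) | k f b.
     (\<forall>n. f n < k) \<and> (\<forall>n\<ge>b. \<exists>m\<ge>b. m \<noteq> n \<and> f m = f n)}"

definition ECT :: weihrauch_problem where
  "ECT = {(coloring_code k f, b) | k f b.
     (\<forall>n. f n < k) \<and> (\<forall>x\<ge>b. \<exists>y>x. f x = f y)}"

end

theory Submission
  imports Defs HOL.Filter
begin

text \<open>
  The reduction of \<^const>\<open>ERT\<close> to \<^const>\<open>ECT\<close> is the identity in both directions: a bound after
  which every colour returns later is in particular a bound after which no colour is isolated,
  and every colouring has an \<^const>\<open>ECT\<close>-solution because finitely many colours occur only
  finitely often.

  That there is no converse reduction is a purely topological fact: a computation that halts has
  read only finitely much of its oracle (\<open>eval_continuous\<close>). Suppose continuous \<open>\<Phi>\<close> and \<open>\<Psi>\<close> reduce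
  \<^const>\<open>ECT\<close> to \<^const>\<open>ERT\<close>. Consider an instance \<open>f\<close> with two colours, \<open>0\<close> and \<open>1\<close>, and let \<open>b\<close>
  be so large that every colour of \<open>\<Phi> f\<close> beyond \<open>b\<close> occurs there at least twice. Then \<open>b\<close> solves
  \<open>\<Phi> f\<close>, so \<open>\<Psi>\<close> converts it into a solution \<open>T\<close> of \<open>f\<close>. Now cut \<open>f\<close> off after some late
  occurrence \<open>i \<ge> T\<close> of the colour \<open>1\<close>, continuing with \<open>0\<close>; call the result \<open>F\<close>. The colour \<open>1\<close>
  does not return after \<open>i\<close>, so \<open>T\<close> does not solve \<open>F\<close>. As \<open>\<Psi>\<close> still returns \<open>T\<close>, the bound \<open>b\<close>
  cannot solve \<open>\<Phi> F\<close>: some colour of \<open>\<Phi> F\<close> occurs exactly once beyond \<open>b\<close>, say at \<open>n\<close>. This does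
  not contradict continuity yet, because \<open>n\<close> may lie beyond the part on which \<open>\<Phi> f\<close> and \<open>\<Phi> F\<close>
  agree.

  Hence \<open>f\<close> is chosen generically (\<open>generic_colouring\<close>): it contains infinitely many ones, each
  followed by a run of zeros so long that \<open>\<Phi> f\<close> agrees with \<open>\<Phi> F\<close> at the position \<open>n\<close> as well.
  Then the colour at \<open>n\<close> is a colour of \<open>\<Phi> f\<close> beyond \<open>b\<close>, it was seen twice there early on, and
  therefore also twice in \<open>\<Phi> F\<close>, which is absurd.
\<close>

section \<open>Halting computations use finitely much of the oracle\<close>

text \<open>
  The neighbourhood filter of a point of Baire space, so that finite intersections of
  neighbourhoods come from the general laws of eventuality.
\<close>

definition nbhd :: "(nat \<Rightarrow> nat) \<Rightarrow> (nat \<Rightarrow> nat) filter" where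
  "nbhd A = (INF u. principal {B. \<forall>n<u. B n = A n})"

lemma eventually_nbhd:
  "eventually P (nbhd A) \<longleftrightarrow> (\<exists>u. \<forall>B. (\<forall>n<u. B n = A n) \<longrightarrow> P B)"
proof -
  have "eventually P (nbhd A) \<longleftrightarrow>
      (\<exists>u\<in>UNIV. eventually P (principal {B. \<forall>n<u. B n = A n}))"
    unfolding nbhd_def
  proof (rule eventually_INF_base)
    fix u v :: nat
    show "\<exists>w\<in>UNIV. principal {B. \<forall>n<w. B n = A n}
        \<le> inf (principal {B. \<forall>n<u. B n = A n}) (principal {B. \<forall>n<v. B n = A n})"
      by (rule bexI[of _ "max u v"]) auto
  qed simp
  then show ?thesis
    by (auto simp: eventually_principal)
qed

lemma eventually_nbhd_self: "eventually P (nbhd A) \<Longrightarrow> P A"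
  by (auto simp: eventually_nbhd)

lemma eventually_nbhd_coordinate: "\<forall>\<^sub>F B in nbhd A. B n = A n"
  by (auto simp: eventually_nbhd intro!: exI[of _ "Suc n"])

lemma those_map_continuous:
  assumes "\<And>g ys y. g \<in> set gs \<Longrightarrow> eval A g xs = Some y \<Longrightarrow> \<forall>\<^sub>F B in nbhd A. eval B g xs = Some y"
    and "those (map (\<lambda>g. eval A g xs) gs) = Some zs"
  shows "\<forall>\<^sub>F B in nbhd A. those (map (\<lambda>g. eval B g xs) gs) = Some zs"
  using assms
proof (induction gs arbitrary: zs)
  case Nil
  then show ?case by simp
next
  case (Cons g gs)
  from Cons.prems(2) obtain y ys where y: "eval A g xs = Some y"
    and ys: "those (map (\<lambda>g. eval A g xs) gs) = Some ys" and zs: "zs = y # ys"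
    by (auto split: option.splits)
  have "\<forall>\<^sub>F B in nbhd A. eval B g xs = Some y"
    using Cons.prems(1) y by simp
  moreover have "\<forall>\<^sub>F B in nbhd A. those (map (\<lambda>g. eval B g xs) gs) = Some ys"
    using Cons.IH Cons.prems(1) ys by simp
  ultimately show ?case
    by eventually_elim (simp add: zs)
qed

text \<open>
  The use principle. In the case of unbounded search, the finitely many values that certify the
  least zero persist nearby, and with them its being least.
\<close>

lemma eval_continuous:
  "eval A e xs = Some y \<Longrightarrow> \<forall>\<^sub>F B in nbhd A. eval B e xs = Some y"
proof (induction e arbitrary: xs y)
  case Oracle
  then obtain x where "xs = [x]" "A x = y"
    by (auto split: list.splits)
  then show ?case
    using eventually_nbhd_coordinate[of x A] by simp
next
  case (Comp f gs)
  from Comp.prems obtain zs where zs: "those (map (\<lambda>g. eval A g xs) gs) = Some zs"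
    and y: "eval A f zs = Some y"
    by (auto simp: bind_eq_Some_conv)
  have "\<forall>\<^sub>F B in nbhd A. those (map (\<lambda>g. eval B g xs) gs) = Some zs"
    using those_map_continuous[OF _ zs] Comp.IH(2) by blast
  moreover have "\<forall>\<^sub>F B in nbhd A. eval B f zs = Some y"
    using Comp.IH(1) y by blast
  ultimately show ?case
    by eventually_elim simp
next
  case (Prec f g)
  define R where "R B ys n =
    rec_nat (eval B f ys) (\<lambda>m r. Option.bind r (\<lambda>v. eval B g (m # v # ys))) n" for B ys n
  from Prec.prems obtain n ys where xs: "xs = n # ys" and "R A ys n = Some y"
    by (auto simp: R_def split: list.splits)
  from this(2) have "\<forall>\<^sub>F B in nbhd A. R B ys n = Some y"
  proof (induction n arbitrary: y)
    case 0
    then show ?case using Prec.IH(1) by (simp add: R_def)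
  next
    case (Suc n)
    then obtain v where v: "R A ys n = Some v" "eval A g (n # v # ys) = Some y"
      by (auto simp: R_def bind_eq_Some_conv)
    have "\<forall>\<^sub>F B in nbhd A. R B ys n = Some v"
      using Suc.IH v(1) .
    moreover have "\<forall>\<^sub>F B in nbhd A. eval B g (n # v # ys) = Some y"
      using Prec.IH(2) v(2) .
    ultimately show ?case
      by eventually_elim (simp add: R_def)
  qed
  then show ?case
    by (simp add: xs R_def)
next
  case (Mu f)
  from Mu.prems obtain z where z: "eval A f (z # xs) = Some 0"
      and def: "\<forall>x<z. eval A f (x # xs) \<noteq> None"
    and y: "y = (LEAST z. eval A f (z # xs) = Some 0)"
    by (auto split: if_splits)
  have zero: "eval A f (y # xs) = Some 0"
    unfolding y using z by (rule LeastI)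
  have "y \<le> z"
    unfolding y using z by (rule Least_le)
  have nonzero: "\<exists>v>0. eval A f (x # xs) = Some v" if "x < y" for x
  proof -
    have "eval A f (x # xs) \<noteq> Some 0"
      using that unfolding y by (rule not_less_Least)
    moreover have "eval A f (x # xs) \<noteq> None"
      using that def \<open>y \<le> z\<close> by simp
    ultimately show ?thesis by (metis gr0I option.exhaust)
  qed
  have "\<forall>\<^sub>F B in nbhd A. \<exists>v>0. eval B f (x # xs) = Some v" if "x < y" for x
  proof -
    from nonzero[OF that] obtain v where "v > 0" "eval A f (x # xs) = Some v" by blast
    from Mu.IH[OF this(2)] show ?thesis
      by eventually_elim (use \<open>v > 0\<close> in blast)
  qed
  then have "\<forall>\<^sub>F B in nbhd A. \<forall>x\<in>{..<y}. \<exists>v>0. eval B f (x # xs) = Some v"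
    by (intro eventually_ball_finite) auto
  moreover have "\<forall>\<^sub>F B in nbhd A. eval B f (y # xs) = Some 0"
    using Mu.IH zero .
  ultimately show ?case
  proof eventually_elim
    case (elim B)
    have "(LEAST z. eval B f (z # xs) = Some 0) = y"
    proof (rule Least_equality)
      fix z assume "eval B f (z # xs) = Some 0"
      then show "y \<le> z" using elim(1) by (force simp: not_less[symmetric])
    qed (rule elim(2))
    moreover have "\<exists>z. eval B f (z # xs) = Some 0 \<and> (\<forall>x<z. eval B f (x # xs) \<noteq> None)"
      using elim by fastforce
    ultimately show ?case by simp
  qed
qed (auto split: list.splits)

section \<open>Colourings and their solutions\<close>

lemma ERT_iff:
  "(J, b) \<in> ERT \<longleftrightarrow> (\<forall>n. J (Suc n) < J 0) \<and>
     (\<forall>n\<ge>b. \<exists>m\<ge>b. m \<noteq> n \<and> J (Suc m) = J (Suc n))" (is "?L \<longleftrightarrow> ?R")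
proof
  assume ?R
  moreover have "J = coloring_code (J 0) (\<lambda>n. J (Suc n))"
    by (auto simp: coloring_code_def fun_eq_iff split: nat.split)
  ultimately show ?L unfolding ERT_def by blast
qed (auto simp: ERT_def coloring_code_def)

lemma ECT_iff:
  "(J, b) \<in> ECT \<longleftrightarrow> (\<forall>n. J (Suc n) < J 0) \<and>
     (\<forall>x\<ge>b. \<exists>y>x. J (Suc x) = J (Suc y))" (is "?L \<longleftrightarrow> ?R")
proof
  assume ?R
  moreover have "J = coloring_code (J 0) (\<lambda>n. J (Suc n))"
    by (auto simp: coloring_code_def fun_eq_iff split: nat.split)
  ultimately show ?L unfolding ECT_def by blast
qed (auto simp: ECT_def coloring_code_def)

lemma ECT_subset_ERT: "ECT \<subseteq> ERT"
proof clarify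
  fix J b assume J: "(J, b) \<in> ECT"
  have "\<exists>m\<ge>b. m \<noteq> n \<and> J (Suc m) = J (Suc n)" if n: "n \<ge> b" for n
  proof -
    from J n obtain y where "y > n" "J (Suc n) = J (Suc y)" by (auto simp: ECT_iff)
    then show ?thesis using n by (intro exI[of _ y]) auto
  qed
  then show "(J, b) \<in> ERT" using J by (auto simp: ERT_iff ECT_iff)
qed

text \<open>
  The positions whose colour occurs only finitely often form a finite union of finite sets.
\<close>

lemma ECT_solvable:
  assumes "\<forall>n. J (Suc n) < J 0"
  shows "\<exists>b. (J, b) \<in> ECT"
proof -
  define V where "V = {v. v < J 0 \<and> finite {x. J (Suc x) = v}}"
  have "finite (\<Union>v\<in>V. {x. J (Suc x) = v})"
    by (auto simp: V_def)
  then obtain b where b: "\<forall>x\<in>(\<Union>v\<in>V. {x. J (Suc x) = v}). x < b"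
    using finite_nat_set_iff_bounded by blast
  have "\<exists>y>x. J (Suc x) = J (Suc y)" if "x \<ge> b" for x
  proof -
    have "J (Suc x) \<notin> V" using b that by fastforce
    then have "infinite {y. J (Suc y) = J (Suc x)}" using assms by (simp add: V_def)
    then have "\<not> {y. J (Suc y) = J (Suc x)} \<subseteq> {..x}" using finite_subset by blast
    then show ?thesis by (auto simp: not_le)
  qed
  then show ?thesis using assms by (auto simp: ECT_iff)
qed

lemma Domain_ERT_iff: "J \<in> Domain ERT \<longleftrightarrow> (\<forall>n. J (Suc n) < J 0)"
proof
  assume "J \<in> Domain ERT"
  then show "\<forall>n. J (Suc n) < J 0" by (simp only: Domain_iff ERT_iff) blast
next
  assume "\<forall>n. J (Suc n) < J 0"
  then show "J \<in> Domain ERT" using ECT_solvable ECT_subset_ERT by blast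
qed

lemma Domain_ECT_iff: "J \<in> Domain ECT \<longleftrightarrow> (\<forall>n. J (Suc n) < J 0)"
proof
  assume "J \<in> Domain ECT"
  then show "\<forall>n. J (Suc n) < J 0" by (simp only: Domain_iff ECT_iff) blast
next
  assume "\<forall>n. J (Suc n) < J 0"
  then show "J \<in> Domain ECT" using ECT_solvable by blast
qed

lemma ERT_le_ECT: "ERT \<le>\<^sub>W ECT"
  unfolding weihrauch_le_def
proof (intro exI conjI)
  show "computable_functional Some"
    unfolding computable_functional_def by (rule exI[of _ Oracle]) simp
  show "computable_functional2 (\<lambda>I. Some)"
    unfolding computable_functional2_def by (rule exI[of _ "Proj 0"]) simp
  show "\<forall>I\<in>Domain ERT. \<exists>J. Some I = Some J \<and> J \<in> Domain ECT \<and>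
      (\<forall>S. (J, S) \<in> ECT \<longrightarrow> (\<exists>T. Some S = Some T \<and> (I, T) \<in> ERT))"
    using ECT_subset_ERT Domain_ERT_iff Domain_ECT_iff by blast
qed

section \<open>A generic two-colouring\<close>

definition cut :: "nat \<Rightarrow> (nat \<Rightarrow> nat) \<Rightarrow> nat \<Rightarrow> nat" where
  "cut i f n = (if n \<le> i then f n else 0)"

text \<open>
  Here \<open>Q i F G\<close> is a property that holds for all \<open>G\<close> sufficiently close to \<open>F\<close>, with no
  uniformity in \<open>i\<close> or \<open>F\<close>. The colouring places a one as soon as all earlier ones allow it: the
  one at \<open>i\<close> reserves all positions below \<open>R i (cut i f)\<close>, which brings \<open>f\<close> close enough to
  \<open>cut i f\<close>. Since \<open>cut i f\<close> depends only on the values up to \<open>i\<close>, this is a well-founded recursion.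
\<close>

lemma generic_colouring:
  assumes Q: "\<And>i F. \<forall>n. F n < 2 \<Longrightarrow> eventually (Q i F) (nbhd F)"
  obtains f :: "nat \<Rightarrow> nat" where "\<forall>n. f n < 2"
    and "\<And>c. \<exists>i\<ge>c. f i = 1 \<and> Q i (cut i f) f"
proof -
  have "\<forall>i F. \<exists>u. (\<forall>n. F n < 2) \<longrightarrow> (\<forall>G. (\<forall>n<u. G n = F n) \<longrightarrow> Q i F G)"
    using Q by (auto simp: eventually_nbhd)
  then obtain R where R: "\<And>i F G. \<forall>n. F n < 2 \<Longrightarrow> \<forall>n<R i F. G n = F n \<Longrightarrow> Q i F G"
    by metis
  let ?free = "\<lambda>f n. \<forall>i<n. f i = 1 \<longrightarrow> R i (cut i f) \<le> n"
  have "\<exists>f::nat \<Rightarrow> nat. \<forall>n. f n = (if ?free f n then 1 else 0)"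
  proof (rule dependent_wellorder_choice)
    fix r n and f g :: "nat \<Rightarrow> nat"
    assume eq: "\<And>i. i < n \<Longrightarrow> f i = g i"
    then have "cut i f = cut i g" if "i < n" for i
      using that by (auto simp: cut_def fun_eq_iff)
    with eq show "(r = (if ?free f n then 1 else 0)) = (r = (if ?free g n then 1 else 0))"
      by auto
  qed blast
  then obtain f :: "nat \<Rightarrow> nat" where f: "\<And>n. f n = (if ?free f n then 1 else 0)"
    by blast
  have binary: "f n < 2" for n
    by (subst f) simp
  have Q_one: "Q i (cut i f) f" if "f i = 1" for i
  proof (rule R)
    show "\<forall>n. cut i f n < 2" using binary by (simp add: cut_def)
    show "\<forall>n<R i (cut i f). f n = cut i f n"
    proof (intro allI impI)
      fix n assume n: "n < R i (cut i f)"
      show "f n = cut i f n"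
      proof (cases "n \<le> i")
        case False
        then have "\<not> ?free f n" using n that by (auto simp: not_le)
        then show ?thesis using f[of n] False by (simp add: cut_def)
      qed (simp add: cut_def)
    qed
  qed
  have "\<exists>i\<ge>c. f i = 1" for c
  proof (rule ccontr)
    assume none: "\<not> (\<exists>i\<ge>c. f i = 1)"
    define n where "n = c + (\<Sum>i<c. R i (cut i f))"
    have "R i (cut i f) \<le> n" if "f i = 1" for i
    proof -
      have "i < c" using none that by (meson not_le)
      then have "R i (cut i f) \<le> (\<Sum>i<c. R i (cut i f))" by (intro member_le_sum) auto
      then show ?thesis by (simp add: n_def)
    qed
    then have "f n = 1" by (subst f) simp
    then show False using none by (simp add: n_def)
  qed
  with Q_one binary that show ?thesis by metis
qed

section \<open>There is no converse reduction\<close>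

lemma eventually_nbhd_coloring_code:
  assumes "eventually P (nbhd (coloring_code k f))"
  shows "\<forall>\<^sub>F g in nbhd f. P (coloring_code k g)"
proof -
  from assms obtain u where u: "\<And>B. \<forall>n<u. B n = coloring_code k f n \<Longrightarrow> P B"
    by (auto simp: eventually_nbhd)
  have "P (coloring_code k g)" if "\<forall>n<u. g n = f n" for g
    using that by (intro u) (auto simp: coloring_code_def split: nat.split)
  then show ?thesis by (auto simp: eventually_nbhd)
qed

text \<open>
  The topological core, with \<open>P\<close> and \<open>e\<close> for the two halves of a reduction restricted to
  two-colourings.
\<close>

lemma no_continuous_reduction:
  fixes P :: "(nat \<Rightarrow> nat) \<Rightarrow> nat \<Rightarrow> nat"
  assumes cont: "\<And>f n. \<forall>m. f m < 2 \<Longrightarrow> \<forall>\<^sub>F g in nbhd f. (\<forall>m. g m < 2) \<longrightarrow> P g n = P f n"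
    and dom: "\<And>f. \<forall>m. f m < 2 \<Longrightarrow> P f \<in> Domain ERT"
    and sol: "\<And>f b. \<forall>m. f m < 2 \<Longrightarrow> (P f, b) \<in> ERT \<Longrightarrow>
      \<exists>T. eval (coloring_code 2 f) e [b] = Some T \<and> (coloring_code 2 f, T) \<in> ECT"
  shows False
proof -
  \<comment> \<open>Every \<open>b \<le> i\<close> that fails for \<open>F\<close> fails because of an isolated colour at a position that \<open>G\<close>
    must reproduce; only finitely many \<open>b\<close> are treated at once, hence the bound \<open>i\<close>.\<close>
  define Q where "Q i F G \<longleftrightarrow> ((\<forall>m. G m < 2) \<longrightarrow> (\<forall>b\<in>{..i}. (P F, b) \<notin> ERT \<longrightarrow>
      (\<exists>n\<ge>b. (\<forall>m\<ge>b. P F (Suc m) = P F (Suc n) \<longrightarrow> m = n) \<and> P G (Suc n) = P F (Suc n))))"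
    for i F G
  have "eventually (Q i F) (nbhd F)" if F: "\<forall>n. F n < 2" for i F
  proof -
    have "\<forall>\<^sub>F G in nbhd F. (\<forall>m. G m < 2) \<longrightarrow> (P F, b) \<notin> ERT \<longrightarrow>
      (\<exists>n\<ge>b. (\<forall>m\<ge>b. P F (Suc m) = P F (Suc n) \<longrightarrow> m = n) \<and> P G (Suc n) = P F (Suc n))" for b
    proof (cases "(P F, b) \<in> ERT")
      case False
      with dom[OF F] obtain n where n: "n \<ge> b" "\<forall>m\<ge>b. P F (Suc m) = P F (Suc n) \<longrightarrow> m = n"
        unfolding ERT_iff Domain_ERT_iff by blast
      from cont[OF F, of "Suc n"] show ?thesis
        by eventually_elim (use n in blast)
    qed simp
    then have "\<forall>\<^sub>F G in nbhd F. \<forall>b\<in>{..i}. (\<forall>m. G m < 2) \<longrightarrow> (P F, b) \<notin> ERT \<longrightarrow>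
      (\<exists>n\<ge>b. (\<forall>m\<ge>b. P F (Suc m) = P F (Suc n) \<longrightarrow> m = n) \<and> P G (Suc n) = P F (Suc n))"
      by (intro eventually_ball_finite) auto
    then show ?thesis
      by eventually_elim (auto simp: Q_def)
  qed
  then obtain f where f: "\<forall>n. f n < 2" and gen: "\<And>c. \<exists>i\<ge>c. f i = 1 \<and> Q i (cut i f) f"
    by (rule generic_colouring[of Q]) blast+
  have bound: "\<forall>n. P f (Suc n) < P f 0"
    using dom[OF f] unfolding Domain_ERT_iff .
  then obtain b where b: "(P f, b) \<in> ECT"
    using ECT_solvable by blast
  then obtain T where T: "eval (coloring_code 2 f) e [b] = Some T"
    using sol f ECT_subset_ERT by blast
  define C where "C = (\<lambda>n. P f (Suc n)) ` {b..}"
  have "C \<subseteq> {..<P f 0}"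
    using bound unfolding C_def by blast
  then have "finite C"
    using finite_subset by blast
  have twice: "\<forall>\<^sub>F g in nbhd f. (\<forall>m. g m < 2) \<longrightarrow>
      (\<exists>x\<ge>b. \<exists>y>x. P g (Suc x) = c \<and> P g (Suc y) = c)" if "c \<in> C" for c
  proof -
    from that obtain x where x: "x \<ge> b" "P f (Suc x) = c" by (auto simp: C_def)
    then obtain y where y: "y > x" "P f (Suc y) = c" using b by (auto simp: ECT_iff)
    from cont[OF f, of "Suc x"] cont[OF f, of "Suc y"] show ?thesis
      by eventually_elim (metis x y)
  qed
  have "\<forall>\<^sub>F g in nbhd f. \<forall>c\<in>C. (\<forall>m. g m < 2) \<longrightarrow>
      (\<exists>x\<ge>b. \<exists>y>x. P g (Suc x) = c \<and> P g (Suc y) = c)"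
    using \<open>finite C\<close> twice by (intro eventually_ball_finite) auto
  moreover have "\<forall>\<^sub>F g in nbhd f. eval (coloring_code 2 g) e [b] = Some T"
    using eventually_nbhd_coloring_code[OF eval_continuous[OF T]] .
  ultimately have "\<forall>\<^sub>F g in nbhd f. (\<forall>c\<in>C. (\<forall>m. g m < 2) \<longrightarrow>
      (\<exists>x\<ge>b. \<exists>y>x. P g (Suc x) = c \<and> P g (Suc y) = c)) \<and> eval (coloring_code 2 g) e [b] = Some T"
    by (rule eventually_conj)
  then obtain u where u: "\<And>g. \<forall>n<u. g n = f n \<Longrightarrow> (\<forall>c\<in>C. (\<forall>m. g m < 2) \<longrightarrow>
      (\<exists>x\<ge>b. \<exists>y>x. P g (Suc x) = c \<and> P g (Suc y) = c)) \<and> eval (coloring_code 2 g) e [b] = Some T"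
    unfolding eventually_nbhd by blast
  obtain i where i: "i \<ge> max u (max b T)" "f i = 1" "Q i (cut i f) f"
    using gen by blast
  define F where "F = cut i f"
  have F: "\<forall>n. F n < 2" using f by (simp add: F_def cut_def)
  have near: "\<forall>n<u. F n = f n" using i(1) by (simp add: F_def cut_def)
  have "(coloring_code 2 F, T) \<notin> ECT"
  proof
    assume "(coloring_code 2 F, T) \<in> ECT"
    then obtain y where "y > i" "F i = F y"
      using i(1) by (auto simp: ECT_iff coloring_code_def)
    then show False using i(2) by (simp add: F_def cut_def)
  qed
  then have "(P F, b) \<notin> ERT"
    using sol[OF F, of b] u[OF near] by auto
  then obtain n where n: "n \<ge> b" "\<forall>m\<ge>b. P F (Suc m) = P F (Suc n) \<longrightarrow> m = n"
      "P f (Suc n) = P F (Suc n)"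
    using i f unfolding Q_def F_def by (metis atMost_iff max.bounded_iff)
  then have "P F (Suc n) \<in> C" by (metis C_def atLeast_iff imageI)
  then obtain x y where "x \<ge> b" "y > x" "P F (Suc x) = P F (Suc n)" "P F (Suc y) = P F (Suc n)"
    using u[OF near] F by blast
  then have "x = n" "y = n" using n(2) by auto
  then show False using \<open>y > x\<close> by simp
qed

lemma not_ECT_le_ERT: "\<not> ECT \<le>\<^sub>W ERT"
proof
  assume "ECT \<le>\<^sub>W ERT"
  then obtain \<Phi> \<Psi> where \<Phi>: "computable_functional \<Phi>" and \<Psi>: "computable_functional2 \<Psi>"
    and red: "\<And>I. I \<in> Domain ECT \<Longrightarrow> \<exists>J. \<Phi> I = Some J \<and> J \<in> Domain ERT \<and>
           (\<forall>S. (J, S) \<in> ERT \<longrightarrow> (\<exists>T. \<Psi> I S = Some T \<and> (I, T) \<in> ECT))"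
    unfolding weihrauch_le_def by blast
  from \<Phi> obtain d where d: "\<And>I J n. \<Phi> I = Some J \<Longrightarrow> eval I d [n] = Some (J n)"
    unfolding computable_functional_def by blast
  from \<Psi> obtain e where e: "\<And>I S T. \<Psi> I S = Some T \<Longrightarrow> eval I e [S] = Some T"
    unfolding computable_functional2_def by blast
  define P where "P f = the (\<Phi> (coloring_code 2 f))" for f
  have P: "\<Phi> (coloring_code 2 f) = Some (P f) \<and> P f \<in> Domain ERT \<and>
      (\<forall>S. (P f, S) \<in> ERT \<longrightarrow>
        (\<exists>T. \<Psi> (coloring_code 2 f) S = Some T \<and> (coloring_code 2 f, T) \<in> ECT))"
    if "\<forall>n. f n < 2" for f
  proof -
    have "coloring_code 2 f \<in> Domain ECT"
      using that by (simp add: Domain_ECT_iff coloring_code_def)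
    from red[OF this] show ?thesis by (auto simp: P_def)
  qed
  have eval_P: "eval (coloring_code 2 f) d [n] = Some (P f n)" if "\<forall>m. f m < 2" for f n
    using d P[OF that] by blast
  show False
  proof (rule no_continuous_reduction[of P e])
    fix f :: "nat \<Rightarrow> nat" and n assume f: "\<forall>m. f m < 2"
    from eventually_nbhd_coloring_code[OF eval_continuous[OF eval_P[OF f, of n]]]
    show "\<forall>\<^sub>F g in nbhd f. (\<forall>m. g m < 2) \<longrightarrow> P g n = P f n"
      by eventually_elim (use eval_P in force)
  qed (use P e in blast)+
qed

theorem mainTheorem6: "ERT <\<^sub>W ECT"
  unfolding weihrauch_less_def using ERT_le_ECT not_ECT_le_ERT by blast

end
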